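(* Let $d\ge1$. If $\kappa_d$ is a quadratic Pisot number (a Pisot number of degree $2$ over $\mathbb{Q}$), then $E_d$ contains no prime power, i.e. $p^k\notin E_d$ for every prime $p$ and every $k\ge1$.
   Context: For integers $d,n\ge1$, $T_d(n)$ is the Cayley graph of $(\mathbb{Z}/n\mathbb{Z})^d$ with respect to $\{\pm e_1,\dots,\pm e_d\}\setminus\{0\}$ ($e_i$ the standard basis vectors); it is a simple graph, and $T_d(1)$ is a single vertex with no edges. $a_d(n)$ is the number of independent sets of $T_d(n)$ (including the empty set). The limit $\kappa_d=\lim_{n\to\infty}a_d(n)^{1/n^d}$ exists and is a positive real number. $E_d=\{n\ge1: a_d(n)=\kappa_d^{n^d}\}$. A Pisot number is a real algebraic integer $\alpha>1$ all of whose other Galois conjugates have absolute value $<1$. *)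

theory Defs
  imports
    Complex_Main
    "HOL-Computational_Algebra.Computational_Algebra"
    "HOL-Algebra.Elementary_Groups"
    "HOL-Algebra.Product_Groups"
begin

definition cayley_edges :: "('a, 'b) monoid_scheme \<Rightarrow> 'a set \<Rightarrow> 'a set set" where
  "cayley_edges G S = {{x, x \<otimes>\<^bsub>G\<^esub> s} | x s. x \<in> carrier G \<and> s \<in> S}"

definition independent_sets :: "'a set \<Rightarrow> 'a set set \<Rightarrow> 'a set set" where
  "independent_sets V E = {I. I \<subseteq> V \<and> (\<forall>u\<in>I. \<forall>v\<in>I. {u, v} \<notin> E)}"

definition torus_group :: "nat \<Rightarrow> nat \<Rightarrow> (nat \<Rightarrow> int) monoid" where
  "torus_group d n = product_group {..<d} (\<lambda>_. integer_mod_group n)"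

text \<open>
  Residues modulo \<open>n\<close> are represented by the integers \<open>0, \<dots>, n - 1\<close>; the reduction of
  \<open>1\<close> matters only for \<open>n = 1\<close>, where every basis vector is the neutral element.
\<close>

definition basis_vector :: "nat \<Rightarrow> nat \<Rightarrow> nat \<Rightarrow> (nat \<Rightarrow> int)" where
  "basis_vector d n i = (\<lambda>j\<in>{..<d}. if j = i then 1 mod int n else 0)"

text \<open>HOL-Algebra writes the group multiplicatively, so \<open>inv\<close> is negation and \<open>\<one>\<close> is zero.\<close>

definition torus_generators :: "nat \<Rightarrow> nat \<Rightarrow> (nat \<Rightarrow> int) set" where
  "torus_generators d n =
     (\<Union>i<d. {basis_vector d n i, inv\<^bsub>torus_group d n\<^esub> (basis_vector d n i)})
       - {\<one>\<^bsub>torus_group d n\<^esub>}"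

definition num_indep :: "nat \<Rightarrow> nat \<Rightarrow> nat" where
  "num_indep d n =
     card (independent_sets (carrier (torus_group d n))
             (cayley_edges (torus_group d n) (torus_generators d n)))"

text \<open>
  The limit exists and is positive for every \<open>d \<ge> 1\<close>, so \<open>lim\<close> denotes it; convergence is not
  proved here. The value of \<open>num_indep d 0\<close> is irrelevant.
\<close>

definition kappa :: "nat \<Rightarrow> real" where
  "kappa d = lim (\<lambda>n. real (num_indep d n) powr (1 / real (n ^ d)))"

definition exact_set :: "nat \<Rightarrow> nat set" where
  "exact_set d = {n. n \<ge> 1 \<and> real (num_indep d n) = kappa d ^ (n ^ d)}"

definition is_min_poly :: "rat poly \<Rightarrow> 'a :: field_char_0 \<Rightarrow> bool" where
  "is_min_poly p x \<longleftrightarrow> lead_coeff p = 1 \<and> irreducible p \<and> poly (map_poly of_rat p) x = 0"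

text \<open>Conjugates and degree are those over the rationals, via the (unique) minimal polynomial.\<close>

definition galois_conjugates :: "complex \<Rightarrow> complex set" where
  "galois_conjugates x = {z. \<exists>p. is_min_poly p x \<and> poly (map_poly of_rat p) z = 0}"

definition pisot :: "real \<Rightarrow> bool" where
  "pisot x \<longleftrightarrow> algebraic_int x \<and> x > 1 \<and>
     (\<forall>z \<in> galois_conjugates (complex_of_real x) - {complex_of_real x}. norm z < 1)"

definition has_degree_over_rat :: "'a :: field_char_0 \<Rightarrow> nat \<Rightarrow> bool" where
  "has_degree_over_rat x m \<longleftrightarrow> (\<exists>p. is_min_poly p x \<and> degree p = m)"

end

theory Submission
  imports Defs "HOL-Computational_Algebra.Field_as_Ring"
begin

text \<open>
  If \<open>\<kappa>\<close> is a Pisot number of degree at least 2, then no power \<open>\<kappa> ^ N\<close> with \<open>N \<ge> 1\<close> is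
  rational: a conjugate \<open>z \<noteq> \<kappa>\<close> would satisfy \<open>z ^ N = \<kappa> ^ N > 1\<close>, although \<open>\<bar>z\<bar> < 1\<close>.
  Since the number of independent sets is an integer, \<open>exact_set d\<close> is in fact empty.
\<close>

lemma map_poly_of_rat_add:
  "map_poly (of_rat :: rat \<Rightarrow> 'a::field_char_0) (p + q) = map_poly of_rat p + map_poly of_rat q"
  by (intro poly_eqI) (simp add: coeff_map_poly of_rat_add)

lemma map_poly_of_rat_mult:
  "map_poly (of_rat :: rat \<Rightarrow> 'a::field_char_0) (p * q) = map_poly of_rat p * map_poly of_rat q"
  by (intro poly_eqI) (simp add: coeff_map_poly coeff_mult of_rat_sum of_rat_mult)

lemma map_poly_of_rat_pderiv:
  "map_poly (of_rat :: rat \<Rightarrow> 'a::field_char_0) (pderiv p) = pderiv (map_poly of_rat p)"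
  by (intro poly_eqI) (simp add: coeff_map_poly coeff_pderiv of_rat_add of_rat_mult)

lemma of_real_of_rat: "complex_of_real (of_rat r) = of_rat r"
  by (cases r) (simp add: of_rat_rat)

lemma poly_map_of_rat_of_real:
  "poly (map_poly of_rat p) (complex_of_real x) = of_real (poly (map_poly of_rat p) x)"
  by (induction p) (simp_all add: map_poly_pCons of_real_of_rat)

text \<open>The degree of \<open>kappa d\<close> is stated over the reals, whereas
  \<open>galois_conjugates\<close> lives in the complex numbers; this lets one minimal polynomial
  serve both.\<close>

lemma is_min_poly_of_real_iff:
  "is_min_poly p (complex_of_real x) \<longleftrightarrow> is_min_poly p x"
  by (simp add: is_min_poly_def poly_map_of_rat_of_real)

text \<open>Irreducibles are prime in the Euclidean domain of rational polynomials, so otherwise p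
  and q would be coprime. Evaluating a Bezout identity \<open>a * p + b * q = 1\<close> at the
  common root x then gives 0 = 1.\<close>

lemma is_min_poly_dvd:
  fixes x :: "'a :: field_char_0"
  assumes "is_min_poly p x" and "poly (map_poly of_rat q) x = 0"
  shows "p dvd q"
proof (rule ccontr)
  assume "\<not> p dvd q"
  moreover have "prime_elem p"
    using assms(1) by (intro irreducible_imp_prime_elem_gcd) (simp add: is_min_poly_def)
  ultimately have "coprime p q"
    by (metis prime_elem_imp_coprime)
  then have "fst (bezout_coefficients p q) * p + snd (bezout_coefficients p q) * q = 1"
    using bezout_coefficients_fst_snd[of p q] by simp
  then obtain a b where "a * p + b * q = 1"
    by blast
  then have "poly (map_poly of_rat (a * p + b * q)) x = (1 :: 'a)"
    by simp
  with assms show False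
    by (simp add: is_min_poly_def map_poly_of_rat_add map_poly_of_rat_mult)
qed

text \<open>Splitting off the linear factor of x leaves a nonconstant complex cofactor, which has a
  root z. Separability in characteristic 0 keeps z away from x.\<close>

lemma is_min_poly_other_root:
  fixes x :: complex
  assumes "is_min_poly p x" and "degree p \<ge> 2"
  obtains z where "poly (map_poly of_rat p) z = 0" and "z \<noteq> x"
proof -
  let ?P = "map_poly of_rat p :: complex poly"
  have "poly ?P x = 0"
    using assms(1) by (simp add: is_min_poly_def)
  then obtain Q where Q: "?P = [:- x, 1:] * Q"
    by (metis dvdE poly_eq_0_iff_dvd)
  have "degree ?P = degree p"
    by (simp add: degree_map_poly)
  moreover from this assms(2) Q have "Q \<noteq> 0"
    by auto
  then have "degree ?P = Suc (degree Q)"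
    unfolding Q by (subst degree_mult_eq) simp_all
  ultimately have "\<not> constant (poly Q)"
    using assms(2) by (simp add: constant_degree)
  then obtain z where z: "poly Q z = 0"
    using fundamental_theorem_of_algebra by blast
  have "z \<noteq> x"
  proof
    assume "z = x"
    \<comment> \<open>By the product rule, the derivative of (X - x) Q takes the value Q(x) = 0 at
      x. Hence p would divide its own derivative, which is nonzero and of smaller degree.\<close>
    with z have "poly (map_poly of_rat (pderiv p)) x = 0"
      by (simp only: map_poly_of_rat_pderiv Q pderiv_mult) (simp add: pderiv_pCons)
    with assms(1) have "p dvd pderiv p"
      by (rule is_min_poly_dvd)
    with assms(2) show False
      using not_dvd_pderiv[of p] by simp
  qed
  with z Q that show thesis
    by simp
qed

lemma pisot_power_irrational:
  assumes "pisot x" and "has_degree_over_rat x m" and "m \<ge> 2" and "N \<ge> 1"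
  shows "x ^ N \<notin> \<rat>"
proof
  assume "x ^ N \<in> \<rat>"
  then obtain r where r: "x ^ N = of_rat r"
    by (auto simp: Rats_def)
  from assms(2,3) obtain p where p: "is_min_poly p (complex_of_real x)" "degree p \<ge> 2"
    by (auto simp: has_degree_over_rat_def is_min_poly_of_real_iff)
  then obtain z where z: "poly (map_poly of_rat p) z = 0" "z \<noteq> complex_of_real x"
    by (rule is_min_poly_other_root)
  then have "norm z < 1"
    using assms(1) p(1) by (auto simp: pisot_def galois_conjugates_def)
  \<comment> \<open>Divisibility of X^N - r by the minimal polynomial transfers the equation
    \<open>x ^ N = of_rat r\<close> to the conjugate z.\<close>
  let ?q = "monom 1 N + [:- r:]"
  have eval: "poly (map_poly of_rat ?q) y = y ^ N - of_rat r" for y :: complex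
    by (simp add: map_poly_of_rat_add map_poly_monom map_poly_pCons poly_monom of_rat_minus)
  have r': "complex_of_real x ^ N = of_rat r"
    using r by (metis of_real_of_rat of_real_power)
  then have "p dvd ?q"
    by (intro is_min_poly_dvd[OF p(1)]) (simp only: eval, simp)
  then have "poly (map_poly of_rat ?q) z = 0"
    using z(1) by (elim dvdE) (simp only: map_poly_of_rat_mult poly_mult, simp)
  with r' have "z ^ N = complex_of_real x ^ N"
    by (simp only: eval, simp)
  then have "norm z ^ N = \<bar>x\<bar> ^ N"
    by (metis norm_of_real norm_power)
  moreover have "norm z ^ N < \<bar>x\<bar> ^ N"
    using \<open>norm z < 1\<close> assms(1,4) by (intro power_strict_mono) (auto simp: pisot_def)
  ultimately show False
    by simp
qed

theorem proposition5p20: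
  fixes d :: nat
  assumes "d \<ge> 1"
    and "pisot (kappa d)" and "has_degree_over_rat (kappa d) 2"
  shows "\<forall>p k :: nat. prime p \<and> k \<ge> 1 \<longrightarrow> p ^ k \<notin> exact_set d"
proof -
  have "n \<notin> exact_set d" for n
  proof
    assume "n \<in> exact_set d"
    then have "n ^ d \<ge> 1" and "kappa d ^ (n ^ d) = real (num_indep d n)"
      by (auto simp: exact_set_def)
    \<comment> \<open>A cardinality is rational, and the exponent is positive because
      \<open>exact_set\<close> excludes n = 0.\<close>
    then show False
      using pisot_power_irrational[OF assms(2,3), of "n ^ d"] by simp
  qed
  then show ?thesis
    by blast
qed

end
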